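(* Let $h:\mathbb{B}^4\times\mathbb{B}\to\mathbb{R}$ be $h(\mathbf{x},z_s)=q(\mathbf{x})+\kappa_s(\mathbf{x})z_s$ with $q\in\mathcal{F}^2$ and $\kappa_s(\mathbf{x})=g_s-\sum_{i=1}^4g_{s,i}x_i$, $g_{s,i}\ge0$, and assume that $\kappa_s(S)\ge0$ for every $S\subseteq\{1,2,3,4\}$ with $|S|\le1$. Then there exist $q''\in\mathcal{F}^2$ (a function of $\mathbf{x}$) and affine functions $\kappa_f(\mathbf{x})=g_f-\sum_ig_{f,i}x_i$, $\kappa_b(\mathbf{x})=g_b-\sum_ig_{b,i}x_i$ with all $g_{f,i},g_{b,i}\ge0$, such that $h''(\mathbf{x},z_f,z_b)=q''(\mathbf{x})+\kappa_f(\mathbf{x})z_f+\kappa_b(\mathbf{x})z_b$ (which is in $\mathcal{F}^2$ and has no $z_fz_b$ term) satisfies $\min_{z_f,z_b}h''(\mathbf{x},z_f,z_b)=\min_{z_s}h(\mathbf{x},z_s)$ for all $\mathbf{x}\in\mathbb{B}^4$, and $z_f,z_b$ are associated with the forward and backward reference partitions respectively: $\kappa_f(S)\ge0$ for $|S|\le2$ and $\kappa_f(S)\le0$ for $|S|\ge3$; $\kappa_b(S)\ge0$ for $|S|\le1$ and $\kappa_b(S)\le0$ for $|S|\ge2$.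
   Context: $\mathbb{B}=\{0,1\}$. $\mathcal{F}^2$: submodular pseudo-Boolean functions of order $\le2$ (multilinear polynomials of degree $\le2$ with non-positive bilinear coefficients). Labelings $\mathbf{x}\in\mathbb{B}^4$ are identified with $S=\{i:x_i=1\}\subseteq\{1,2,3,4\}$, and $\kappa(S)$ means $\kappa$ evaluated at that labeling. The forward reference partition puts the sets of size $\ge3$ in the "$z=1$" part and the others in the "$z=0$" part; the backward reference partition puts the sets of size $\ge2$ in the "$z=1$" part. *)

theory Defs
  imports "HOL-Analysis.Analysis"
begin

text \<open>
  A labeling of a finite index type \<open>'v\<close> is a function \<open>'v \<Rightarrow> bool\<close>; the element \<open>b\<close> of
  \<open>{0,1}\<close> is represented by a truth value and enters formulas as \<open>of_bool b\<close>.
  The index set \<open>{1,2,3,4}\<close> is the numeral type \<open>4\<close>, whose elements are \<open>1, 2, 3, 4\<close>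
  (with \<open>4 = 0\<close>).
\<close>

definition labeling :: "'v set \<Rightarrow> 'v \<Rightarrow> bool" where
  "labeling S = (\<lambda>i. i \<in> S)"

definition multilinear :: "('v::finite set \<Rightarrow> real) \<Rightarrow> ('v \<Rightarrow> bool) \<Rightarrow> real" where
  "multilinear c x = (\<Sum>S\<in>UNIV. c S * (\<Prod>i\<in>S. of_bool (x i)))"

text \<open>The class $\mathcal{F}^2$, for an arbitrary finite set of variables.\<close>

definition F2 :: "(('v::finite \<Rightarrow> bool) \<Rightarrow> real) set" where
  "F2 = {f. \<exists>c. (\<forall>S. card S > 2 \<longrightarrow> c S = 0) \<and> (\<forall>S. card S = 2 \<longrightarrow> c S \<le> 0) \<and>
                 f = multilinear c}"

definition submodular :: "(('v \<Rightarrow> bool) \<Rightarrow> real) \<Rightarrow> bool" where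
  "submodular f \<longleftrightarrow> (\<forall>x y. f (inf x y) + f (sup x y) \<le> f x + f y)"

lemma multilinear_labeling:
  fixes c :: "'v::finite set \<Rightarrow> real"
  shows "multilinear c (labeling T) = (\<Sum>S\<in>Pow T. c S)"
proof -
  have *: "(\<Prod>i\<in>S. of_bool (labeling T i)) = (of_bool (S \<subseteq> T) :: real)" for S :: "'v set"
    by (induction S rule: infinite_finite_induct) (auto simp: labeling_def)
  have "multilinear c (labeling T) = (\<Sum>S\<in>UNIV. if S \<in> Pow T then c S else 0)"
    unfolding multilinear_def * by (intro sum.cong) auto
  then show ?thesis
    by (simp add: sum.If_cases Pow_def)
qed

text \<open>
  \<open>F2\<close> consists of the submodular functions (in the lattice sense) among those given by
  a multilinear polynomial of degree at most two.
\<close>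

lemma F2_iff_submodular:
  fixes f :: "('v::finite \<Rightarrow> bool) \<Rightarrow> real"
  shows "f \<in> F2 \<longleftrightarrow>
    submodular f \<and> (\<exists>c. (\<forall>S. card S > 2 \<longrightarrow> c S = 0) \<and> f = multilinear c)"
proof (intro iffI conjI)
  assume "f \<in> F2"
  then obtain c where c0: "\<And>S. card S > 2 \<Longrightarrow> c S = 0" and c2: "\<And>S. card S = 2 \<Longrightarrow> c S \<le> 0"
    and f: "f = multilinear c"
    by (auto simp: F2_def)
  then show "\<exists>c. (\<forall>S. card S > 2 \<longrightarrow> c S = 0) \<and> f = multilinear c" by blast
  let ?P = "\<lambda>x S. \<Prod>i\<in>S. of_bool (x i) :: real"
  have "c S * ?P (inf x y) S + c S * ?P (sup x y) S \<le> c S * ?P x S + c S * ?P y S"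
    for x y :: "'v \<Rightarrow> bool" and S
  proof -
    consider "card S = 0" | "card S = 1" | "card S = 2" | "card S > 2" by linarith
    then show ?thesis
    proof cases
      case 1 then show ?thesis by simp
    next
      case 2
      then obtain i where "S = {i}" by (auto simp: card_1_singleton_iff)
      then show ?thesis by (auto simp: of_bool_def)
    next
      case 3
      then obtain i j where "S = {i, j}" "i \<noteq> j" by (auto simp: card_2_iff)
      then show ?thesis using c2[OF 3] by (auto simp: of_bool_def)
    next
      case 4 then show ?thesis by (simp add: c0)
    qed
  qed
  then show "submodular f"
    unfolding submodular_def f multilinear_def sum.distrib[symmetric] by (intro allI sum_mono)
next
  assume *: "submodular f \<and> (\<exists>c. (\<forall>S. card S > 2 \<longrightarrow> c S = 0) \<and> f = multilinear c)"
  then obtain c where c0: "\<forall>S. card S > 2 \<longrightarrow> c S = 0" and f: "f = multilinear c" by blast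
  have "c S \<le> 0" if S: "card S = 2" for S
  proof -
    obtain i j where ij: "S = {i, j}" "i \<noteq> j" using S by (auto simp: card_2_iff)
    have "f (inf (labeling {i}) (labeling {j})) + f (sup (labeling {i}) (labeling {j}))
            \<le> f (labeling {i}) + f (labeling {j})"
      using * by (auto simp: submodular_def)
    also have "inf (labeling {i}) (labeling {j}) = labeling {}"
      using ij by (auto simp: labeling_def fun_eq_iff)
    also have "sup (labeling {i}) (labeling {j}) = labeling {i, j}"
      by (auto simp: labeling_def fun_eq_iff)
    finally show ?thesis
      using ij by (auto simp: f multilinear_labeling Pow_insert doubleton_eq_iff)
  qed
  with c0 f show "f \<in> F2" by (auto simp: F2_def)
qed

definition kappa :: "real \<Rightarrow> ('v::finite \<Rightarrow> real) \<Rightarrow> ('v \<Rightarrow> bool) \<Rightarrow> real" where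
  "kappa g a x = g - (\<Sum>i\<in>UNIV. a i * of_bool (x i))"

text \<open>
  A reference partition of the labelings is given by its \<open>z = 1\<close> part; the \<open>z = 0\<close> part is
  the complement.
\<close>

definition forward_part :: "4 set set" where
  "forward_part = {S. card S \<ge> 3}"

definition backward_part :: "4 set set" where
  "backward_part = {S. card S \<ge> 2}"

definition associated :: "(('v \<Rightarrow> bool) \<Rightarrow> real) \<Rightarrow> 'v set set \<Rightarrow> bool" where
  "associated k P \<longleftrightarrow>
     (\<forall>S. S \<notin> P \<longrightarrow> k (labeling S) \<ge> 0) \<and> (\<forall>S. S \<in> P \<longrightarrow> k (labeling S) \<le> 0)"

text \<open>
  A function of a labeling and two further Boolean variables, as a function of a single
  labeling of the disjoint union of the two index sets.
\<close>

definition joint :: "(('v \<Rightarrow> bool) \<Rightarrow> bool \<Rightarrow> bool \<Rightarrow> real) \<Rightarrow> ('v + 2 \<Rightarrow> bool) \<Rightarrow> real" where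
  "joint h y = h (\<lambda>i. y (Inl i)) (y (Inr 1)) (y (Inr 2))"

end

theory Submission
  imports Defs
begin

text \<open>
  Write \<open>F S = max 0 (a(S) - g)\<close> for the excess of the given affine function, so that
  \<open>min 0 \<kappa> = - F\<close>. One looks for a decomposition of \<open>F\<close> into nonnegative pair terms, a backward
  excess (with weights \<open>b\<close>, \<open>b\<^sub>i\<close>) and a forward excess (with weights \<open>f\<close>, \<open>f\<^sub>i\<close>). The backward weights
  are chosen according to which pairs of the sorted coefficients exceed \<open>g\<close>; the pair terms are
  then forced by the sets of size two, and the forward weights by the larger sets.
\<close>

section \<open>Sign conditions on the weights and the decomposition for sorted coefficients\<close>

definition backward_admissible :: "real \<Rightarrow> real \<Rightarrow> real \<Rightarrow> real \<Rightarrow> real \<Rightarrow> bool" where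
  "backward_admissible b b1 b2 b3 b4 \<longleftrightarrow>
    0 \<le> b1 \<and> 0 \<le> b2 \<and> 0 \<le> b3 \<and> 0 \<le> b4 \<and> b1 \<le> b \<and> b2 \<le> b \<and> b3 \<le> b \<and> b4 \<le> b \<and>
    b \<le> b1 + b2 \<and> b \<le> b1 + b3 \<and> b \<le> b1 + b4 \<and> b \<le> b2 + b3 \<and> b \<le> b2 + b4 \<and> b \<le> b3 + b4"

definition forward_admissible :: "real \<Rightarrow> real \<Rightarrow> real \<Rightarrow> real \<Rightarrow> real \<Rightarrow> bool" where
  "forward_admissible f f1 f2 f3 f4 \<longleftrightarrow>
    0 \<le> f1 \<and> 0 \<le> f2 \<and> 0 \<le> f3 \<and> 0 \<le> f4 \<and>
    f1 + f2 \<le> f \<and> f1 + f3 \<le> f \<and> f1 + f4 \<le> f \<and> f2 + f3 \<le> f \<and> f2 + f4 \<le> f \<and> f3 + f4 \<le> f \<and>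
    f \<le> f1 + f2 + f3 \<and> f \<le> f1 + f2 + f4 \<and> f \<le> f1 + f3 + f4 \<and> f \<le> f2 + f3 + f4"

text \<open>Nonnegative weights make the affine function antitone in the set, so the inequalities at
  sizes one and two settle its sign at every size. For \<open>forward_admissible\<close> the
  decisive sizes are two and three.\<close>

lemma min_backward:
  assumes "backward_admissible b b1 b2 b3 b4"
  shows "min 0 (b - (b1 * of_bool i + b2 * of_bool j + b3 * of_bool k + b4 * of_bool l)) =
    (if of_bool i + of_bool j + of_bool k + of_bool l \<ge> (2 :: nat)
     then b - (b1 * of_bool i + b2 * of_bool j + b3 * of_bool k + b4 * of_bool l) else 0)"
  using assms unfolding backward_admissible_def
  by (cases i; cases j; cases k; cases l) (simp_all add: min_def)

lemma min_forward:
  assumes "forward_admissible f f1 f2 f3 f4"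
  shows "min 0 (f - (f1 * of_bool i + f2 * of_bool j + f3 * of_bool k + f4 * of_bool l)) =
    (if of_bool i + of_bool j + of_bool k + of_bool l \<ge> (3 :: nat)
     then f - (f1 * of_bool i + f2 * of_bool j + f3 * of_bool k + f4 * of_bool l) else 0)"
  using assms unfolding forward_admissible_def
  by (cases i; cases j; cases k; cases l) (simp_all add: min_def)

text \<open>
  The last ten inequalities say that, once the pair terms and the backward excess are removed,
  the residual values on triples are nonnegative and any two of them sum to at most the residual
  value on the whole set.
\<close>

lemma backward_weights:
  fixes g g1 g2 g3 g4 :: real
  defines "m \<equiv> \<lambda>t. max 0 (t - g)"
  assumes g: "g1 \<le> g" "g2 \<le> g1" "g3 \<le> g2" "g4 \<le> g3" "0 \<le> g4"
  obtains b b1 b2 b3 b4 where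
    "backward_admissible b b1 b2 b3 b4"
    "b1 + b2 - b \<le> m (g1 + g2)" "b1 + b3 - b \<le> m (g1 + g3)" "b1 + b4 - b \<le> m (g1 + g4)"
    "b2 + b3 - b \<le> m (g2 + g3)" "b2 + b4 - b \<le> m (g2 + g4)" "b3 + b4 - b \<le> m (g3 + g4)"
    "2 * b - b1 - b2 - b3 \<le> m (g1 + g2 + g3) - m (g1 + g2) - m (g1 + g3) - m (g2 + g3)"
    "2 * b - b1 - b2 - b4 \<le> m (g1 + g2 + g4) - m (g1 + g2) - m (g1 + g4) - m (g2 + g4)"
    "2 * b - b1 - b3 - b4 \<le> m (g1 + g3 + g4) - m (g1 + g3) - m (g1 + g4) - m (g3 + g4)"
    "2 * b - b2 - b3 - b4 \<le> m (g2 + g3 + g4) - m (g2 + g3) - m (g2 + g4) - m (g3 + g4)"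
    "m (g1 + g2 + g3) + m (g1 + g2 + g4) + m (g3 + g4) - m (g1 + g2) - m (g1 + g2 + g3 + g4) \<le> b3 + b4 - b"
    "m (g1 + g2 + g3) + m (g1 + g3 + g4) + m (g2 + g4) - m (g1 + g3) - m (g1 + g2 + g3 + g4) \<le> b2 + b4 - b"
    "m (g1 + g2 + g3) + m (g2 + g3 + g4) + m (g1 + g4) - m (g2 + g3) - m (g1 + g2 + g3 + g4) \<le> b1 + b4 - b"
    "m (g1 + g2 + g4) + m (g1 + g3 + g4) + m (g2 + g3) - m (g1 + g4) - m (g1 + g2 + g3 + g4) \<le> b2 + b3 - b"
    "m (g1 + g2 + g4) + m (g2 + g3 + g4) + m (g1 + g3) - m (g2 + g4) - m (g1 + g2 + g3 + g4) \<le> b1 + b3 - b"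
    "m (g1 + g3 + g4) + m (g2 + g3 + g4) + m (g1 + g2) - m (g3 + g4) - m (g1 + g2 + g3 + g4) \<le> b1 + b2 - b"
proof -
  \<comment> \<open>Sorting orders the pair sums as 12, 13, then 14 and 23 (mutually incomparable),
    then 24, then 34. The cases record where \<open>g\<close> cuts this order.\<close>
  consider
      (a) "g1 + g4 \<le> g" "g2 + g3 \<le> g"
    | (b) "g \<le> g1 + g4" "g2 + g3 \<le> g"
    | (c) "g1 + g4 \<le> g" "g \<le> g2 + g3"
    | (d) "g \<le> g1 + g4" "g \<le> g2 + g3" "g2 + g4 \<le> g"
    | (e) "g \<le> g2 + g4" "g3 + g4 \<le> g"
    | (f) "g \<le> g3 + g4"
    using g by linarith
  then show thesis
  proof cases
    case a
    \<comment> \<open>Only the pairs 12 and 13 can exceed \<open>g\<close>; no backward excess is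
      required.\<close>
    show thesis
      by (rule that[of 0 0 0 0 0];
        use a g in \<open>simp add: m_def backward_admissible_def\<close>; linarith?)
  next
    case b
    \<comment> \<open>Pairs inside \<open>{2,3,4}\<close> carry no excess:
      \<open>b2 = b3 = b4 = t\<close> and \<open>b = 2 * t\<close> keep the backward excess zero on
      them and give that triple its full value \<open>t\<close>. In \<open>b1\<close>, the bound
      \<open>g - g1\<close> keeps the residuals of triples through 1 nonnegative, and the bound
      \<open>t\<close> ensures \<open>b \<le> b1 + b2\<close>.\<close>
    define t where "t = m (g2 + g3 + g4)"
    show thesis
      by (rule that[of "2 * t" "2 * t - min (g - g1) t" t t t];
        use b g in \<open>simp add: m_def backward_admissible_def t_def\<close>; (linarith | simp add: min_def max_def)?)
  next
    case c
    \<comment> \<open>So \<open>t = max 0 (g1 + g2 + g3 + g4 - 2 * g)\<close>. The backward excess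
      is \<open>t\<close> on pairs inside \<open>{1,2,3}\<close> and zero on pairs through 4.
      Triples through 4 have residual \<open>g4\<close>; \<open>t\<close> is the least nonnegative
      value for which \<open>2 * g4\<close> is at most the residual on the whole set.\<close>
    define t where "t = m (g1 + g2 + g3 + g4 - g)"
    show thesis
      by (rule that[of t t t t 0];
        use c g in \<open>simp add: m_def backward_admissible_def t_def\<close>; (linarith | simp add: min_def max_def)?)
  next
    case d
    \<comment> \<open>All residuals vanish, so the forward excess is zero. The weights absorb 14 and
      23 exactly, leaving pair terms \<open>g - g3 - g4\<close> on 12 and \<open>g - g2 - g4\<close>
      on 13.\<close>
    show thesis
      by (rule that[of "g2 + g3 + 2 * g4 - g" "g1 + g2 + g3 + 2 * g4 - 2 * g"
          "g2 + g3 + g4 - g" "g2 + g3 + g4 - g" g4];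
        use d g in \<open>simp add: m_def backward_admissible_def\<close>; linarith?)
  next
    case e
    \<comment> \<open>Again no residual: every pair is matched exactly except 12, whose pair term is
      \<open>g - g3 - g4\<close>.\<close>
    show thesis
      by (rule that[of "g3 + g4" "g1 + g3 + g4 - g" "g2 + g3 + g4 - g" g3 g4];
        use e g in \<open>simp add: m_def backward_admissible_def\<close>; linarith?)
  next
    case f
    \<comment> \<open>Every pair reaches \<open>g\<close>, so the given function is itself backward
      admissible.\<close>
    show thesis
      by (rule that[of g g1 g2 g3 g4];
        use f g in \<open>simp add: m_def backward_admissible_def\<close>; linarith?)
  qed
qed

text \<open>
  The residue left after removing the pair terms and the backward excess vanishes on sets of
  size at most two. Such a function, with values \<open>t\<^sub>i\<close> on the triple missing \<open>i\<close> and \<open>e\<close> on the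
  whole set, is the forward excess with weights \<open>f\<^sub>i = e - t\<^sub>i\<close> and \<open>f = 3 * e - (\<Sum>i. t\<^sub>i)\<close>; this is
  admissible iff all \<open>t\<^sub>i \<ge> 0\<close> and \<open>t\<^sub>i + t\<^sub>j \<le> e\<close> for \<open>i \<noteq> j\<close>.
\<close>

lemma excess_decomposition:
  fixes g g1 g2 g3 g4 :: real
  assumes g: "g1 \<le> g" "g2 \<le> g1" "g3 \<le> g2" "g4 \<le> g3" "0 \<le> g4"
  obtains p12 p13 p14 p23 p24 p34 b b1 b2 b3 b4 f f1 f2 f3 f4 where
    "0 \<le> p12" "0 \<le> p13" "0 \<le> p14" "0 \<le> p23" "0 \<le> p24" "0 \<le> p34"
    "backward_admissible b b1 b2 b3 b4" "forward_admissible f f1 f2 f3 f4"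
    "\<forall>i j k l. - p12 * (of_bool i * of_bool j) + - p13 * (of_bool i * of_bool k)
      + - p14 * (of_bool i * of_bool l) + - p23 * (of_bool j * of_bool k)
      + - p24 * (of_bool j * of_bool l) + - p34 * (of_bool k * of_bool l)
      + min 0 (f - (f1 * of_bool i + f2 * of_bool j + f3 * of_bool k + f4 * of_bool l))
      + min 0 (b - (b1 * of_bool i + b2 * of_bool j + b3 * of_bool k + b4 * of_bool l))
      = min 0 (g - (g1 * of_bool i + g2 * of_bool j + g3 * of_bool k + g4 * of_bool l))"
proof -
  define m where "m = (\<lambda>t. max 0 (t - g))"
  obtain b b1 b2 b3 b4 where b:
    "backward_admissible b b1 b2 b3 b4"
    "b1 + b2 - b \<le> m (g1 + g2)" "b1 + b3 - b \<le> m (g1 + g3)" "b1 + b4 - b \<le> m (g1 + g4)"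
    "b2 + b3 - b \<le> m (g2 + g3)" "b2 + b4 - b \<le> m (g2 + g4)" "b3 + b4 - b \<le> m (g3 + g4)"
    "2 * b - b1 - b2 - b3 \<le> m (g1 + g2 + g3) - m (g1 + g2) - m (g1 + g3) - m (g2 + g3)"
    "2 * b - b1 - b2 - b4 \<le> m (g1 + g2 + g4) - m (g1 + g2) - m (g1 + g4) - m (g2 + g4)"
    "2 * b - b1 - b3 - b4 \<le> m (g1 + g3 + g4) - m (g1 + g3) - m (g1 + g4) - m (g3 + g4)"
    "2 * b - b2 - b3 - b4 \<le> m (g2 + g3 + g4) - m (g2 + g3) - m (g2 + g4) - m (g3 + g4)"
    "m (g1 + g2 + g3) + m (g1 + g2 + g4) + m (g3 + g4) - m (g1 + g2) - m (g1 + g2 + g3 + g4) \<le> b3 + b4 - b"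
    "m (g1 + g2 + g3) + m (g1 + g3 + g4) + m (g2 + g4) - m (g1 + g3) - m (g1 + g2 + g3 + g4) \<le> b2 + b4 - b"
    "m (g1 + g2 + g3) + m (g2 + g3 + g4) + m (g1 + g4) - m (g2 + g3) - m (g1 + g2 + g3 + g4) \<le> b1 + b4 - b"
    "m (g1 + g2 + g4) + m (g1 + g3 + g4) + m (g2 + g3) - m (g1 + g4) - m (g1 + g2 + g3 + g4) \<le> b2 + b3 - b"
    "m (g1 + g2 + g4) + m (g2 + g3 + g4) + m (g1 + g3) - m (g2 + g4) - m (g1 + g2 + g3 + g4) \<le> b1 + b3 - b"
    "m (g1 + g3 + g4) + m (g2 + g3 + g4) + m (g1 + g2) - m (g3 + g4) - m (g1 + g2 + g3 + g4) \<le> b1 + b2 - b"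
    unfolding m_def by (rule backward_weights[OF g])
  define p12 where "p12 = m (g1 + g2) - (b1 + b2 - b)"
  define p13 where "p13 = m (g1 + g3) - (b1 + b3 - b)"
  define p14 where "p14 = m (g1 + g4) - (b1 + b4 - b)"
  define p23 where "p23 = m (g2 + g3) - (b2 + b3 - b)"
  define p24 where "p24 = m (g2 + g4) - (b2 + b4 - b)"
  define p34 where "p34 = m (g3 + g4) - (b3 + b4 - b)"
  define t1 where "t1 = m (g2 + g3 + g4) - p23 - p24 - p34 - (b2 + b3 + b4 - b)"
  define t2 where "t2 = m (g1 + g3 + g4) - p13 - p14 - p34 - (b1 + b3 + b4 - b)"
  define t3 where "t3 = m (g1 + g2 + g4) - p12 - p14 - p24 - (b1 + b2 + b4 - b)"
  define t4 where "t4 = m (g1 + g2 + g3) - p12 - p13 - p23 - (b1 + b2 + b3 - b)"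
  define e where "e = m (g1 + g2 + g3 + g4) - p12 - p13 - p14 - p23 - p24 - p34
                        - (b1 + b2 + b3 + b4 - b)"
  note defs = p12_def p13_def p14_def p23_def p24_def p34_def
  have p: "0 \<le> p12" "0 \<le> p13" "0 \<le> p14" "0 \<le> p23" "0 \<le> p24" "0 \<le> p34"
    using b(2-7) by (simp_all add: defs)
  have t: "0 \<le> t1" "0 \<le> t2" "0 \<le> t3" "0 \<le> t4"
    unfolding t1_def t2_def t3_def t4_def defs using b(8-11) by linarith+
  have tt: "t1 + t2 \<le> e" "t1 + t3 \<le> e" "t1 + t4 \<le> e" "t2 + t3 \<le> e" "t2 + t4 \<le> e" "t3 + t4 \<le> e"
    unfolding t1_def t2_def t3_def t4_def e_def defs using b(12-17) by linarith+
  define f1 f2 f3 f4 where "f1 = e - t1" and "f2 = e - t2" and "f3 = e - t3" and "f4 = e - t4"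
  define f where "f = 3 * e - t1 - t2 - t3 - t4"
  note f_defs = f_def f1_def f2_def f3_def f4_def
  have f: "forward_admissible f f1 f2 f3 f4"
    unfolding forward_admissible_def f_defs using t tt by linarith
  have eq: "m (g1 + g2) = p12 + (b1 + b2 - b)" "m (g1 + g3) = p13 + (b1 + b3 - b)"
    "m (g1 + g4) = p14 + (b1 + b4 - b)" "m (g2 + g3) = p23 + (b2 + b3 - b)"
    "m (g2 + g4) = p24 + (b2 + b4 - b)" "m (g3 + g4) = p34 + (b3 + b4 - b)"
    "m (g1 + g2 + g3) = p12 + p13 + p23 + (b1 + b2 + b3 - b) + (f1 + f2 + f3 - f)"
    "m (g1 + g2 + g4) = p12 + p14 + p24 + (b1 + b2 + b4 - b) + (f1 + f2 + f4 - f)"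
    "m (g1 + g3 + g4) = p13 + p14 + p34 + (b1 + b3 + b4 - b) + (f1 + f3 + f4 - f)"
    "m (g2 + g3 + g4) = p23 + p24 + p34 + (b2 + b3 + b4 - b) + (f2 + f3 + f4 - f)"
    "m (g1 + g2 + g3 + g4) = p12 + p13 + p14 + p23 + p24 + p34
       + (b1 + b2 + b3 + b4 - b) + (f1 + f2 + f3 + f4 - f)"
    by (simp_all add: defs f_defs t1_def t2_def t3_def t4_def e_def)
  \<comment> \<open>The empty set and the singletons carry no excess; with \<open>eq\<close> this
    covers all sixteen labelings.\<close>
  have small: "m 0 = 0" "m g1 = 0" "m g2 = 0" "m g3 = 0" "m g4 = 0"
    using g by (simp_all add: m_def)
  have min_m: "min 0 (g - t) = - m t" for t
    by (simp add: m_def min_def max_def)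
  have "- p12 * (of_bool i * of_bool j) + - p13 * (of_bool i * of_bool k)
      + - p14 * (of_bool i * of_bool l) + - p23 * (of_bool j * of_bool k)
      + - p24 * (of_bool j * of_bool l) + - p34 * (of_bool k * of_bool l)
      + min 0 (f - (f1 * of_bool i + f2 * of_bool j + f3 * of_bool k + f4 * of_bool l))
      + min 0 (b - (b1 * of_bool i + b2 * of_bool j + b3 * of_bool k + b4 * of_bool l))
      = min 0 (g - (g1 * of_bool i + g2 * of_bool j + g3 * of_bool k + g4 * of_bool l))"
    for i j k l
    unfolding min_forward[OF f] min_backward[OF b(1)] min_m
    by (cases i; cases j; cases k; cases l) (simp_all add: eq small)
  then show thesis
    by (intro that[OF p b(1) f] allI)
qed

section \<open>Closure properties of \<open>F2\<close>\<close>

lemma F2_add: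
  assumes "f \<in> F2" "g \<in> F2"
  shows "(\<lambda>x. f x + g x) \<in> F2"
proof -
  obtain c d where
    c: "\<forall>S. card S > 2 \<longrightarrow> c S = 0" "\<forall>S. card S = 2 \<longrightarrow> c S \<le> 0" "f = multilinear c" and
    d: "\<forall>S. card S > 2 \<longrightarrow> d S = 0" "\<forall>S. card S = 2 \<longrightarrow> d S \<le> 0" "g = multilinear d"
    using assms by (auto simp: F2_def)
  have "(\<lambda>x. f x + g x) = multilinear (\<lambda>S. c S + d S)"
    by (simp add: c d multilinear_def fun_eq_iff sum.distrib algebra_simps)
  moreover have "\<forall>S. card S = 2 \<longrightarrow> c S + d S \<le> 0"
    using c(2) d(2) by (simp add: add_nonpos_nonpos)
  ultimately show ?thesis
    using c(1) d(1) by (auto simp: F2_def intro!: exI[of _ "\<lambda>S. c S + d S"])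
qed

lemma F2_monomial:
  assumes "card S \<le> 2" "card S = 2 \<Longrightarrow> c \<le> 0"
  shows "(\<lambda>x. c * (\<Prod>i\<in>S. of_bool (x i))) \<in> F2"
proof -
  have "(\<lambda>x. c * (\<Prod>i\<in>S. of_bool (x i))) = multilinear (\<lambda>T. if T = S then c else 0)"
    by (simp add: multilinear_def fun_eq_iff if_distrib[of "\<lambda>u. u * _"] cong: if_cong)
  then show ?thesis
    using assms by (auto simp: F2_def intro!: exI[of _ "\<lambda>T. if T = S then c else 0"])
qed

lemma F2_linear: "(\<lambda>x. c * of_bool (x i)) \<in> F2"
  using F2_monomial[of "{i}" c] by simp

lemma F2_bilinear: "i \<noteq> j \<Longrightarrow> c \<le> 0 \<Longrightarrow> (\<lambda>x. c * (of_bool (x i) * of_bool (x j))) \<in> F2"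
  using F2_monomial[of "{i, j}" c] by simp

lemma F2_sum:
  assumes "finite A" "\<And>a. a \<in> A \<Longrightarrow> f a \<in> F2"
  shows "(\<lambda>x. \<Sum>a\<in>A. f a x) \<in> F2"
  using assms
proof (induction rule: finite_induct)
  case empty
  then show ?case using F2_linear[of 0] by simp
next
  case (insert a A)
  then show ?case by (simp add: F2_add)
qed

text \<open>Used to read \<open>q''\<close> as a function on the disjoint union of variables.
  Injectivity preserves the size of each monomial, hence both the degree bound and the sign
  condition.\<close>

lemma F2_reindex:
  assumes "f \<in> F2" "inj \<phi>"
  shows "(\<lambda>y. f (\<lambda>i. y (\<phi> i))) \<in> F2"
proof -
  obtain c where c: "\<forall>S. card S > 2 \<longrightarrow> c S = 0" "\<forall>S. card S = 2 \<longrightarrow> c S \<le> 0" "f = multilinear c"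
    using assms(1) by (auto simp: F2_def)
  have "(\<lambda>y. c S * (\<Prod>i\<in>S. of_bool (y (\<phi> i)))) \<in> F2" for S
  proof (cases "card S > 2")
    case True
    then show ?thesis using c(1) F2_linear[of 0] by simp
  next
    case False
    have inj: "inj_on \<phi> S"
      using assms(2) by (rule inj_on_subset) simp
    then have "card (\<phi> ` S) = card S"
      by (rule card_image)
    then have "(\<lambda>y. c S * (\<Prod>i\<in>\<phi> ` S. of_bool (y i))) \<in> F2"
      using False c(2) by (intro F2_monomial) auto
    then show ?thesis
      by (simp add: prod.reindex[OF inj])
  qed
  then show ?thesis
    unfolding c(3) multilinear_def by (intro F2_sum) auto
qed

text \<open>The product expands into a linear term and mixed bilinear terms with coefficients
  \<open>- a i\<close>; their two variables lie in different summands, hence are distinct.\<close>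

lemma F2_kappa_times:
  assumes "\<And>i. 0 \<le> a i"
  shows "(\<lambda>y. kappa g a (\<lambda>i. y (Inl i)) * of_bool (y (Inr n))) \<in> F2"
proof -
  have "kappa g a (\<lambda>i. y (Inl i)) * of_bool (y (Inr n)) =
      g * of_bool (y (Inr n)) + (\<Sum>i\<in>UNIV. - a i * (of_bool (y (Inl i)) * of_bool (y (Inr n))))" for y
    by (cases "y (Inr n)") (simp_all add: kappa_def sum_negf)
  moreover have "(\<lambda>y. g * of_bool (y (Inr n)) + (\<Sum>i\<in>UNIV. - a i * (of_bool (y (Inl i)) * of_bool (y (Inr n))))) \<in> F2"
    using assms by (intro F2_add F2_sum F2_linear F2_bilinear) auto
  ultimately show ?thesis
    by presburger
qed

section \<open>Minimisation over Boolean variables and sorting of the coefficients\<close>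

lemma Min_bool_affine: "(MIN z\<in>UNIV. c + k * of_bool z) = c + min 0 (k :: real)"
  by (auto simp: UNIV_bool min_def)

text \<open>With no product of \<open>z\<close> and \<open>w\<close>, the two minimisations
  separate.\<close>

lemma Min_bool_pair_affine:
  "(MIN (z, w)\<in>UNIV. c + k * of_bool z + l * of_bool w) = c + min 0 k + min 0 (l :: real)"
proof -
  have *: "(UNIV :: (bool \<times> bool) set) = {(False, False), (False, True), (True, False), (True, True)}"
    by auto
  show ?thesis
    unfolding * by (simp add: min_def)
qed

text \<open>Both reference partitions depend only on cardinality, so the coefficients may be treated
  in decreasing order.\<close>

lemma obtain_sorted_4:
  fixes a :: "4 \<Rightarrow> real"
  obtains i j k l where "distinct [i, j, k, l]" "UNIV = {i, j, k, l}" "a j \<le> a i" "a k \<le> a j" "a l \<le> a k"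
proof -
  obtain xs :: "4 list" where xs: "set xs = UNIV" "distinct xs"
    using finite_distinct_list[OF finite] by blast
  define ys where "ys = sort_key (\<lambda>i. - a i) xs"
  have ys: "set ys = UNIV" "distinct ys" "sorted (map (\<lambda>i. - a i) ys)"
    using xs by (simp_all add: ys_def)
  have "length ys = 4"
    using distinct_card[OF ys(2)] by (simp add: ys(1))
  then obtain i j k l where "ys = [i, j, k, l]"
    by (auto simp: numeral_eq_Suc length_Suc_conv)
  then show thesis
    using that[of i j k l] ys by auto
qed

theorem theorem2:
  fixes h :: "(4 \<Rightarrow> bool) \<Rightarrow> bool \<Rightarrow> real"
    and q \<kappa>\<^sub>s :: "(4 \<Rightarrow> bool) \<Rightarrow> real"
    and g\<^sub>s :: real and a\<^sub>s :: "4 \<Rightarrow> real"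
  assumes "q \<in> F2"
    and "\<And>i. a\<^sub>s i \<ge> 0"
    and "\<kappa>\<^sub>s = kappa g\<^sub>s a\<^sub>s"
    and "\<And>x z. h x z = q x + \<kappa>\<^sub>s x * of_bool z"
    and "\<And>S. card S \<le> 1 \<Longrightarrow> \<kappa>\<^sub>s (labeling S) \<ge> 0"
  shows "\<exists>(q'' :: (4 \<Rightarrow> bool) \<Rightarrow> real) \<kappa>\<^sub>f \<kappa>\<^sub>b g\<^sub>f a\<^sub>f g\<^sub>b a\<^sub>b h''.
      q'' \<in> F2 \<and>
      (\<forall>i. a\<^sub>f i \<ge> 0) \<and> \<kappa>\<^sub>f = kappa g\<^sub>f a\<^sub>f \<and>
      (\<forall>i. a\<^sub>b i \<ge> 0) \<and> \<kappa>\<^sub>b = kappa g\<^sub>b a\<^sub>b \<and>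
      (\<forall>x z\<^sub>f z\<^sub>b. h'' x z\<^sub>f z\<^sub>b = q'' x + \<kappa>\<^sub>f x * of_bool z\<^sub>f + \<kappa>\<^sub>b x * of_bool z\<^sub>b) \<and>
      joint h'' \<in> F2 \<and>
      (\<forall>x. (MIN (z\<^sub>f, z\<^sub>b)\<in>UNIV. h'' x z\<^sub>f z\<^sub>b) = (MIN z\<^sub>s\<in>UNIV. h x z\<^sub>s)) \<and>
      associated \<kappa>\<^sub>f forward_part \<and>
      associated \<kappa>\<^sub>b backward_part"
proof -
  obtain i j k l :: 4 where dist: "distinct [i, j, k, l]" and UN: "UNIV = {i, j, k, l}"
    and sorted: "a\<^sub>s j \<le> a\<^sub>s i" "a\<^sub>s k \<le> a\<^sub>s j" "a\<^sub>s l \<le> a\<^sub>s k"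
    by (rule obtain_sorted_4)
  have ne: "i \<noteq> j" "i \<noteq> k" "i \<noteq> l" "j \<noteq> k" "j \<noteq> l" "k \<noteq> l"
    and ne': "j \<noteq> i" "k \<noteq> i" "l \<noteq> i" "k \<noteq> j" "l \<noteq> j" "l \<noteq> k"
    using dist by auto
  have sum4: "(\<Sum>v\<in>UNIV. w v) = w i + w j + w k + w l" for w :: "4 \<Rightarrow> 'b :: comm_monoid_add"
    unfolding UN using dist by (simp add: add.assoc)
  have card4: "card S = of_bool (i \<in> S) + of_bool (j \<in> S) + of_bool (k \<in> S) + of_bool (l \<in> S)"
    for S :: "4 set"
  proof -
    have "card S = (\<Sum>v\<in>UNIV. of_bool (v \<in> S))"
      by (simp add: of_bool_def sum.If_cases)
    then show ?thesis by (simp only: sum4)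
  qed
  \<comment> \<open>The singleton of the largest coefficient bounds it by \<open>g\<^sub>s\<close>,
    which starts the chain of inequalities for \<open>excess_decomposition\<close>.\<close>
  have "kappa g\<^sub>s a\<^sub>s (labeling {i}) \<ge> 0"
    using assms(5)[of "{i}"] by (simp add: assms(3))
  then have ai: "a\<^sub>s i \<le> g\<^sub>s"
    by (simp add: kappa_def sum4 labeling_def ne')
  obtain p12 p13 p14 p23 p24 p34 b b1 b2 b3 b4 f f1 f2 f3 f4 where
    p: "0 \<le> p12" "0 \<le> p13" "0 \<le> p14" "0 \<le> p23" "0 \<le> p24" "0 \<le> p34" and
    b: "backward_admissible b b1 b2 b3 b4" and f: "forward_admissible f f1 f2 f3 f4" and
    eq: "\<forall>i' j' k' l'. - p12 * (of_bool i' * of_bool j') + - p13 * (of_bool i' * of_bool k')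
      + - p14 * (of_bool i' * of_bool l') + - p23 * (of_bool j' * of_bool k')
      + - p24 * (of_bool j' * of_bool l') + - p34 * (of_bool k' * of_bool l')
      + min 0 (f - (f1 * of_bool i' + f2 * of_bool j' + f3 * of_bool k' + f4 * of_bool l'))
      + min 0 (b - (b1 * of_bool i' + b2 * of_bool j' + b3 * of_bool k' + b4 * of_bool l'))
      = min 0 (g\<^sub>s - (a\<^sub>s i * of_bool i' + a\<^sub>s j * of_bool j' + a\<^sub>s k * of_bool k' + a\<^sub>s l * of_bool l'))"
    by (rule excess_decomposition[OF ai sorted assms(2)])
  \<comment> \<open>The weights return from sorted positions to the original indices; the last
    branch is the index \<open>l\<close>.\<close>
  define a\<^sub>b where "a\<^sub>b = (\<lambda>v. if v = i then b1 else if v = j then b2 else if v = k then b3 else b4)"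
  define a\<^sub>f where "a\<^sub>f = (\<lambda>v. if v = i then f1 else if v = j then f2 else if v = k then f3 else f4)"
  define r :: "(4 \<Rightarrow> bool) \<Rightarrow> real" where
    "r = (\<lambda>x. - p12 * (of_bool (x i) * of_bool (x j)) + - p13 * (of_bool (x i) * of_bool (x k))
      + - p14 * (of_bool (x i) * of_bool (x l)) + - p23 * (of_bool (x j) * of_bool (x k))
      + - p24 * (of_bool (x j) * of_bool (x l)) + - p34 * (of_bool (x k) * of_bool (x l)))"
  define q'' where "q'' = (\<lambda>x. q x + r x)"
  define h'' where "h'' = (\<lambda>x z\<^sub>f z\<^sub>b. q'' x + kappa f a\<^sub>f x * of_bool z\<^sub>f + kappa b a\<^sub>b x * of_bool z\<^sub>b)"
  have \<kappa>\<^sub>s: "\<kappa>\<^sub>s x = g\<^sub>s - (a\<^sub>s i * of_bool (x i) + a\<^sub>s j * of_bool (x j) + a\<^sub>s k * of_bool (x k) + a\<^sub>s l * of_bool (x l))"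
    for x by (simp add: assms(3) kappa_def sum4)
  have \<kappa>\<^sub>b: "kappa b a\<^sub>b x = b - (b1 * of_bool (x i) + b2 * of_bool (x j) + b3 * of_bool (x k) + b4 * of_bool (x l))"
    for x by (simp add: kappa_def sum4 a\<^sub>b_def ne')
  have \<kappa>\<^sub>f: "kappa f a\<^sub>f x = f - (f1 * of_bool (x i) + f2 * of_bool (x j) + f3 * of_bool (x k) + f4 * of_bool (x l))"
    for x by (simp add: kappa_def sum4 a\<^sub>f_def ne')
  have nonneg: "0 \<le> a\<^sub>b v" "0 \<le> a\<^sub>f v" for v
    using b f by (simp_all add: a\<^sub>b_def a\<^sub>f_def backward_admissible_def forward_admissible_def)
  have "r \<in> F2"
    unfolding r_def using p ne by (intro F2_add F2_bilinear) simp_all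
  then have q'': "q'' \<in> F2"
    unfolding q''_def using assms(1) by (rule F2_add[rotated])
  have "joint h'' \<in> F2"
    unfolding joint_def[abs_def] h''_def using nonneg
    by (intro F2_add F2_kappa_times F2_reindex[OF q'']) auto
  moreover have "associated (kappa f a\<^sub>f) forward_part"
    unfolding associated_def forward_part_def mem_Collect_eq card4 \<kappa>\<^sub>f labeling_def
    using f by (auto simp: of_bool_def forward_admissible_def)
  moreover have "associated (kappa b a\<^sub>b) backward_part"
    unfolding associated_def backward_part_def mem_Collect_eq card4 \<kappa>\<^sub>b labeling_def
    using b by (auto simp: of_bool_def backward_admissible_def)
  moreover have "(MIN (z\<^sub>f, z\<^sub>b)\<in>UNIV. h'' x z\<^sub>f z\<^sub>b) = (MIN z\<^sub>s\<in>UNIV. h x z\<^sub>s)" for x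
  proof -
    \<comment> \<open>Each auxiliary variable contributes the minimum of 0 and its affine factor, so
      equality of the minima is the decomposition evaluated at the truth values of
      \<open>x\<close>.\<close>
    have "r x + min 0 (kappa f a\<^sub>f x) + min 0 (kappa b a\<^sub>b x) = min 0 (\<kappa>\<^sub>s x)"
      unfolding r_def \<kappa>\<^sub>f \<kappa>\<^sub>b \<kappa>\<^sub>s by (rule eq[rule_format])
    then show ?thesis
      by (simp add: h''_def q''_def assms(4) Min_bool_affine Min_bool_pair_affine)
  qed
  moreover have "h'' x z\<^sub>f z\<^sub>b = q'' x + kappa f a\<^sub>f x * of_bool z\<^sub>f + kappa b a\<^sub>b x * of_bool z\<^sub>b" for x z\<^sub>f z\<^sub>b
    by (simp add: h''_def)
  ultimately show ?thesis
    using q'' nonneg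
    by - (rule exI[of _ q''], rule exI[of _ "kappa f a\<^sub>f"], rule exI[of _ "kappa b a\<^sub>b"],
        rule exI[of _ f], rule exI[of _ a\<^sub>f], rule exI[of _ b], rule exI[of _ a\<^sub>b],
        rule exI[of _ h''], intro conjI allI refl)
qed

end
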